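(* In the quantum number-in-hand network model, for every integer $d\ge1$ there is a quantum protocol with communication cost $O(kd\log^2 k)$ qubits which, with probability at least $2/3$, outputs the list of all max-$d$-isolated cliques of the input $k$-node graph.
   Context: Quantum number-in-hand (NIH) network model: the input is an undirected graph $G=(V,E)$ without self-loops on $V=[k]$; player $v$ receives only $\nu_v\in\{0,1\}^k$, the characteristic vector of its neighborhood; each player sends one quantum message depending only on its own input (no shared randomness or entanglement) to a referee who produces the output; cost is the total number of qubits sent. A set $S\subseteq V$ is a max-$d$-isolated clique if the induced subgraph $G[S]$ is a clique and each node of $S$ has at most $d$ neighbors in $V\setminus S$. *)

theory Defs
  imports Complex_Main "HOL-Library.FuncSet"
begin

definition graph_on :: "nat \<Rightarrow> (nat \<Rightarrow> nat \<Rightarrow> bool) \<Rightarrow> bool" where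
  "graph_on k G \<longleftrightarrow> (\<forall>u v. G u v \<longrightarrow> u < k \<and> v < k) \<and> (\<forall>u v. G u v \<longrightarrow> G v u) \<and> (\<forall>v. \<not> G v v)"

text \<open>Input of player v: its neighbourhood (the support of the characteristic vector nu_v).\<close>
definition nbhd :: "nat \<Rightarrow> (nat \<Rightarrow> nat \<Rightarrow> bool) \<Rightarrow> nat \<Rightarrow> nat set" where
  "nbhd k G v = {u. u < k \<and> G v u}"

definition is_clique :: "(nat \<Rightarrow> nat \<Rightarrow> bool) \<Rightarrow> nat set \<Rightarrow> bool" where
  "is_clique G S \<longleftrightarrow> (\<forall>u\<in>S. \<forall>v\<in>S. u \<noteq> v \<longrightarrow> G u v)"

definition max_d_isolated_clique :: "nat \<Rightarrow> (nat \<Rightarrow> nat \<Rightarrow> bool) \<Rightarrow> nat \<Rightarrow> nat set \<Rightarrow> bool" where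
  "max_d_isolated_clique k G d S \<longleftrightarrow>
     S \<subseteq> {..<k} \<and> S \<noteq> {} \<and> is_clique G S \<and>
     (\<forall>v\<in>S. card {u. u < k \<and> u \<notin> S \<and> G v u} \<le> d)"

definition isolated_cliques :: "nat \<Rightarrow> (nat \<Rightarrow> nat \<Rightarrow> bool) \<Rightarrow> nat \<Rightarrow> nat set set" where
  "isolated_cliques k G d = {S. max_d_isolated_clique k G d S}"

text \<open>Operators on the Hilbert space with orthonormal basis B, as matrices B x B -> complex.\<close>
definition psd_on :: "'b set \<Rightarrow> ('b \<Rightarrow> 'b \<Rightarrow> complex) \<Rightarrow> bool" where
  "psd_on B M \<longleftrightarrow> (\<forall>x :: 'b \<Rightarrow> complex.
      (\<Sum>i\<in>B. \<Sum>j\<in>B. cnj (x i) * M i j * x j) \<in> \<real> \<and>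
      0 \<le> Re (\<Sum>i\<in>B. \<Sum>j\<in>B. cnj (x i) * M i j * x j))"

definition density_on :: "'b set \<Rightarrow> ('b \<Rightarrow> 'b \<Rightarrow> complex) \<Rightarrow> bool" where
  "density_on B \<rho> \<longleftrightarrow> psd_on B \<rho> \<and> (\<Sum>i\<in>B. \<rho> i i) = 1"

definition qubit_basis :: "nat \<Rightarrow> nat set" where
  "qubit_basis m = {0..<2 ^ m}"

text \<open>Basis of the joint system of the k messages (tensor product), player v sending m v qubits.\<close>
definition joint_basis :: "nat \<Rightarrow> (nat \<Rightarrow> nat) \<Rightarrow> (nat \<Rightarrow> nat) set" where
  "joint_basis k m = (\<Pi>\<^sub>E v\<in>{..<k}. qubit_basis (m v))"

text \<open>A quantum NIH protocol for k players:
  m v = number of qubits sent by player v;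
  \<rho> v N = (mixed) state sent by player v on input neighbourhood N;
  the referee performs a POVM {E w | w in Outs} on the joint message, outcome w being the output.\<close>
definition nih_protocol ::
  "nat \<Rightarrow> (nat \<Rightarrow> nat) \<Rightarrow> (nat \<Rightarrow> nat set \<Rightarrow> nat \<Rightarrow> nat \<Rightarrow> complex) \<Rightarrow> 'o set
   \<Rightarrow> ('o \<Rightarrow> (nat \<Rightarrow> nat) \<Rightarrow> (nat \<Rightarrow> nat) \<Rightarrow> complex) \<Rightarrow> bool" where
  "nih_protocol k m \<rho> Outs E \<longleftrightarrow>
     (\<forall>v<k. \<forall>N. N \<subseteq> {..<k} \<longrightarrow> density_on (qubit_basis (m v)) (\<rho> v N)) \<and>
     finite Outs \<and>
     (\<forall>w\<in>Outs. psd_on (joint_basis k m) (E w)) \<and>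
     (\<forall>i\<in>joint_basis k m. \<forall>j\<in>joint_basis k m.
        (\<Sum>w\<in>Outs. E w i j) = (if i = j then 1 else 0))"

definition nih_cost :: "nat \<Rightarrow> (nat \<Rightarrow> nat) \<Rightarrow> nat" where
  "nih_cost k m = (\<Sum>v<k. m v)"

definition joint_state ::
  "nat \<Rightarrow> (nat \<Rightarrow> nat set \<Rightarrow> nat \<Rightarrow> nat \<Rightarrow> complex) \<Rightarrow> (nat \<Rightarrow> nat \<Rightarrow> bool)
   \<Rightarrow> (nat \<Rightarrow> nat) \<Rightarrow> (nat \<Rightarrow> nat) \<Rightarrow> complex" where
  "joint_state k \<rho> G i j = (\<Prod>v<k. \<rho> v (nbhd k G v) (i v) (j v))"

definition output_prob ::
  "nat \<Rightarrow> (nat \<Rightarrow> nat) \<Rightarrow> (nat \<Rightarrow> nat set \<Rightarrow> nat \<Rightarrow> nat \<Rightarrow> complex) \<Rightarrow> 'o set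
   \<Rightarrow> ('o \<Rightarrow> (nat \<Rightarrow> nat) \<Rightarrow> (nat \<Rightarrow> nat) \<Rightarrow> complex) \<Rightarrow> (nat \<Rightarrow> nat \<Rightarrow> bool) \<Rightarrow> 'o \<Rightarrow> real" where
  "output_prob k m \<rho> Outs E G w =
     (if w \<in> Outs then Re (\<Sum>i\<in>joint_basis k m. \<Sum>j\<in>joint_basis k m. E w i j * joint_state k \<rho> G j i)
      else 0)"

end

(* Classical messages with private coins suffice, so all states are diagonal. A player whose
   neighbourhood is X sends a uniform element of a set M X of n messages, where the sets M X pairwise
   meet in at most k elements. The unbounded referee tests every candidate set S: it keeps S if each
   v in S sent a message lying in M (S - {v} + D) for some set D of at most d nodes outside S. True
   isolated cliques always survive. A node v in S whose neighbourhood is not of this form passes with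
   probability at most delta = (k+1)^(d+1) / n, independently of the other nodes. A false S all of
   whose nodes are of this kind survives with probability delta^|S|, which beats the number k^|S| of
   such S. Any other false S contains a node whose neighbourhood determines S up to at most d
   elements, so there are only k (k+1)^d of them. Taking log n = O(d log k) makes the total error
   small. *)

theory Submission
  imports Defs "HOL-Library.Discrete_Functions"
begin

section \<open>Classical randomized protocols as diagonal quantum protocols\<close>

lemma psd_on_diagonal:
  assumes "finite B" and "\<And>i. i \<in> B \<Longrightarrow> 0 \<le> c i"
  shows "psd_on B (\<lambda>i j. if i = j then complex_of_real (c i) else 0)"
proof -
  have "(\<Sum>i\<in>B. \<Sum>j\<in>B. cnj (x i) * (if i = j then complex_of_real (c i) else 0) * x j)
      = complex_of_real (\<Sum>i\<in>B. c i * (cmod (x i))^2)" for x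
  proof -
    have "(\<Sum>j\<in>B. cnj (x i) * (if i = j then complex_of_real (c i) else 0) * x j)
      = complex_of_real (c i * (cmod (x i))^2)" if "i \<in> B" for i
    proof -
      have "(\<Sum>j\<in>B. cnj (x i) * (if i = j then complex_of_real (c i) else 0) * x j)
        = (\<Sum>j\<in>B. if i = j then cnj (x i) * complex_of_real (c i) * x i else 0)"
        by (intro sum.cong) auto
      also have "\<dots> = cnj (x i) * complex_of_real (c i) * x i"
        using assms(1) that by simp
      also have "\<dots> = complex_of_real (c i * (cmod (x i))^2)"
        by (simp add: complex_norm_square mult_ac del: of_real_power)
      finally show ?thesis .
    qed
    then show ?thesis by simp
  qed
  then show ?thesis
    unfolding psd_on_def by (auto intro!: sum_nonneg mult_nonneg_nonneg assms(2))
qed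

text \<open>Each player sends the uniform mixture of the basis states in \<open>M N\<close>, and the
  referee measures in the computational basis and applies \<open>ref\<close> to the result. All
  matrices are diagonal, so the outcome probability is a fraction of message tuples, and the rest of
  the argument is pure counting.\<close>

lemma classical_nih_protocol:
  fixes M :: "nat set \<Rightarrow> nat set" and Outs :: "'o set"
  assumes M: "\<And>N. N \<subseteq> {..<k} \<Longrightarrow> M N \<subseteq> {..<2 ^ a} \<and> card (M N) = n"
    and n: "n > 0"
    and Outs: "finite Outs" "\<And>i. ref i \<in> Outs"
  obtains \<rho> E where "nih_protocol k (\<lambda>v. a) \<rho> Outs E"
    and "\<And>G w. w \<in> Outs \<Longrightarrow> output_prob k (\<lambda>v. a) \<rho> Outs E G w =
      real (card {i \<in> (\<Pi>\<^sub>E v\<in>{..<k}. M (nbhd k G v)). ref i = w}) / real n ^ k"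
proof -
  define \<rho> :: "nat \<Rightarrow> nat set \<Rightarrow> nat \<Rightarrow> nat \<Rightarrow> complex" where
    "\<rho> = (\<lambda>v N x y. if x = y then complex_of_real (if x \<in> M N then 1 / real n else 0) else 0)"
  define E :: "'o \<Rightarrow> (nat \<Rightarrow> nat) \<Rightarrow> (nat \<Rightarrow> nat) \<Rightarrow> complex" where
    "E = (\<lambda>w i j. if i = j then complex_of_real (if ref i = w then 1 else 0) else 0)"
  define J where "J = joint_basis k (\<lambda>v. a)"
  have J: "finite J" unfolding J_def joint_basis_def qubit_basis_def by (intro finite_PiE) auto
  have "density_on (qubit_basis a) (\<rho> v N)" if "N \<subseteq> {..<k}" for v N
  proof -
    have "(\<Sum>i\<in>qubit_basis a. \<rho> v N i i) = (\<Sum>i\<in>M N. complex_of_real (1 / real n))"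
      using M[OF that] unfolding \<rho>_def qubit_basis_def
      by (intro sum.mono_neutral_cong_right) auto
    also have "\<dots> = 1" using M[OF that] n by simp
    finally show ?thesis
      unfolding density_on_def \<rho>_def by (intro conjI psd_on_diagonal) (auto simp: qubit_basis_def)
  qed
  moreover have "psd_on J (E w)" for w
    unfolding E_def using J by (intro psd_on_diagonal) auto
  moreover have "(\<Sum>w\<in>Outs. E w i j) = (if i = j then 1 else 0)" for i j
  proof -
    have "(\<Sum>w\<in>Outs. E w i j) = (\<Sum>w\<in>Outs. if ref i = w then (if i = j then 1 else 0) else 0)"
      unfolding E_def by (intro sum.cong) auto
    then show ?thesis using Outs by simp
  qed
  ultimately have "nih_protocol k (\<lambda>v. a) \<rho> Outs E"
    unfolding nih_protocol_def J_def[symmetric] using Outs by auto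
  moreover have "output_prob k (\<lambda>v. a) \<rho> Outs E G w =
      real (card {i \<in> (\<Pi>\<^sub>E v\<in>{..<k}. M (nbhd k G v)). ref i = w}) / real n ^ k"
    if w: "w \<in> Outs" for G w
  proof -
    define \<Omega> where "\<Omega> = (\<Pi>\<^sub>E v\<in>{..<k}. M (nbhd k G v))"
    have N: "nbhd k G v \<subseteq> {..<k}" for v by (auto simp: nbhd_def)
    have sub: "\<Omega> \<subseteq> J" unfolding \<Omega>_def J_def joint_basis_def qubit_basis_def
      using M[OF N] by (intro PiE_mono) (auto simp: subset_iff)
    have state: "joint_state k \<rho> G i i = complex_of_real (if i \<in> \<Omega> then 1 / real n ^ k else 0)"
      if "i \<in> J" for i
    proof (cases "i \<in> \<Omega>")
      case True
      then have "joint_state k \<rho> G i i = (\<Prod>v<k. complex_of_real (1 / real n))"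
        unfolding joint_state_def \<rho>_def \<Omega>_def by (intro prod.cong) (auto simp: PiE_iff)
      then show ?thesis using True by (simp add: power_divide)
    next
      case False
      \<comment> \<open>Membership in \<open>J\<close> already makes \<open>i\<close> extensional,
        so leaving \<open>\<Omega>\<close> can only mean that some coordinate is a message of weight
        zero, which kills the product.\<close>
      then obtain v where "v < k" "i v \<notin> M (nbhd k G v)"
        using \<open>i \<in> J\<close> unfolding \<Omega>_def J_def joint_basis_def PiE_iff by auto
      then have "joint_state k \<rho> G i i = 0"
        unfolding joint_state_def \<rho>_def by (intro prod_zero) auto
      then show ?thesis using False by simp
    qed
    have "(\<Sum>i\<in>J. \<Sum>j\<in>J. E w i j * joint_state k \<rho> G j i)
        = (\<Sum>i\<in>J. if i \<in> {i\<in>\<Omega>. ref i = w} then complex_of_real (1 / real n ^ k) else 0)"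
    proof (intro sum.cong refl)
      fix i assume i: "i \<in> J"
      have "(\<Sum>j\<in>J. E w i j * joint_state k \<rho> G j i)
          = (\<Sum>j\<in>J. if i = j then E w i i * joint_state k \<rho> G i i else 0)"
        unfolding E_def by (intro sum.cong) auto
      also have "\<dots> = E w i i * joint_state k \<rho> G i i" using J i by simp
      finally show "(\<Sum>j\<in>J. E w i j * joint_state k \<rho> G j i)
          = (if i \<in> {i\<in>\<Omega>. ref i = w} then complex_of_real (1 / real n ^ k) else 0)"
        unfolding state[OF i] E_def by auto
    qed
    also have "\<dots> = (\<Sum>i\<in>{i\<in>\<Omega>. ref i = w}. complex_of_real (1 / real n ^ k))"
      using J sub by (intro sum.mono_neutral_cong_right) auto
    finally show ?thesis
      using w unfolding output_prob_def J_def[symmetric] \<Omega>_def[symmetric] by simp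
  qed
  ultimately show thesis by (rule that)
qed

section \<open>A code with few agreements and the message sets derived from it\<close>

text \<open>Union bound over the sets \<open>T\<close> of k+1 positions on which \<open>g\<close>
  copies \<open>w\<close>: at most n^(k+1) choices of \<open>T\<close>, each of which fixes k+1
  symbols out of an alphabet of size 2n. Taking the alphabet twice as large as the length leaves the
  factor 2^(k+1).\<close>

lemma card_words_agreeing_le:
  fixes w :: "nat \<Rightarrow> nat"
  assumes n: "n > 0"
  shows "card {g \<in> {..<n} \<rightarrow>\<^sub>E {..<2*n}. card {r. r < n \<and> g r = w r} > k} * 2 ^ Suc k \<le> (2*n) ^ n"
proof -
  define Ts where "Ts = {T. T \<subseteq> {..<n} \<and> card T = Suc k}"
  define P where "P = (\<lambda>T. \<Pi>\<^sub>E r\<in>{..<n}. if r \<in> T then {w r} else {..<2*n})"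
  have finTs: "finite Ts" unfolding Ts_def by simp
  have cardP: "card (P T) * (2*n) ^ Suc k = (2*n) ^ n" if "T \<in> Ts" for T
  proof -
    have T: "T \<subseteq> {..<n}" "card T = Suc k" "finite T"
      using that finite_subset unfolding Ts_def by auto
    have "card (P T) = (\<Prod>r\<in>{..<n}. if r \<in> T then 1 else 2*n)"
      unfolding P_def by (subst card_PiE) (auto intro!: prod.cong)
    also have "\<dots> = (\<Prod>r\<in>{..<n} - T. 2*n)"
      by (intro prod.mono_neutral_cong_right) auto
    also have "\<dots> = (2*n) ^ (n - Suc k)"
      using T by (simp add: card_Diff_subset)
    finally have "card (P T) * (2*n) ^ Suc k = (2*n) ^ (n - Suc k + Suc k)"
      by (simp only: power_add)
    \<comment> \<open>The existence of \<open>T\<close> shows that the subtraction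
      \<open>n - Suc k\<close> is not truncated.\<close>
    moreover have "Suc k \<le> n" using T card_mono[of "{..<n}" T] by simp
    ultimately show ?thesis by simp
  qed
  have "{g \<in> {..<n} \<rightarrow>\<^sub>E {..<2*n}. card {r. r < n \<and> g r = w r} > k} \<subseteq> (\<Union>T\<in>Ts. P T)"
  proof
    fix g assume "g \<in> {g \<in> {..<n} \<rightarrow>\<^sub>E {..<2*n}. card {r. r < n \<and> g r = w r} > k}"
    then have g: "g \<in> {..<n} \<rightarrow>\<^sub>E {..<2*n}" and c: "Suc k \<le> card {r. r < n \<and> g r = w r}" by auto
    obtain T where "T \<subseteq> {r. r < n \<and> g r = w r}" "card T = Suc k"
      using obtain_subset_with_card_n[OF c] by metis
    then have "T \<in> Ts" "g \<in> P T"
      using g unfolding Ts_def P_def by (auto simp: PiE_iff)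
    then show "g \<in> (\<Union>T\<in>Ts. P T)" by auto
  qed
  then have "card {g \<in> {..<n} \<rightarrow>\<^sub>E {..<2*n}. card {r. r < n \<and> g r = w r} > k} \<le> card (\<Union>T\<in>Ts. P T)"
    by (intro card_mono finite_UN_I finTs) (auto simp: P_def intro!: finite_PiE)
  also have "\<dots> \<le> (\<Sum>T\<in>Ts. card (P T))" by (rule card_UN_le[OF finTs])
  finally have "card {g \<in> {..<n} \<rightarrow>\<^sub>E {..<2*n}. card {r. r < n \<and> g r = w r} > k} * (2*n) ^ Suc k
      \<le> (\<Sum>T\<in>Ts. card (P T)) * (2*n) ^ Suc k" by (rule mult_right_mono) simp
  also have "\<dots> = (\<Sum>T\<in>Ts. (2*n) ^ n)" unfolding sum_distrib_right using cardP by simp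
  also have "\<dots> = (n choose Suc k) * (2*n) ^ n"
    unfolding Ts_def by (simp add: n_subsets)
  also have "\<dots> \<le> n ^ Suc k * (2*n) ^ n"
    by (cases "Suc k \<le> n") (auto simp: binomial_le_pow binomial_eq_0 simp del: power_Suc)
  finally have "n ^ Suc k * (card {g \<in> {..<n} \<rightarrow>\<^sub>E {..<2*n}. card {r. r < n \<and> g r = w r} > k} * 2 ^ Suc k)
      \<le> n ^ Suc k * (2*n) ^ n"
    by (simp add: power_mult_distrib mult_ac)
  then show ?thesis using n by simp
qed

text \<open>A Gilbert-Varshamov code, chosen greedily: it replaces a polynomial hash family, which would
  need a prime of prescribed size.\<close>

lemma exists_code:
  assumes "finite X" "card X \<le> 2 ^ k" "n > 0"
  shows "\<exists>h :: 'a \<Rightarrow> nat \<Rightarrow> nat. (\<forall>x\<in>X. h x \<in> {..<n} \<rightarrow>\<^sub>E {..<2*n}) \<and>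
    (\<forall>x\<in>X. \<forall>y\<in>X. x \<noteq> y \<longrightarrow> card {r. r < n \<and> h x r = h y r} \<le> k)"
  using assms(1,2)
proof (induction X rule: finite_induct)
  case empty
  then show ?case by auto
next
  case (insert z X)
  then obtain h :: "'a \<Rightarrow> nat \<Rightarrow> nat" where h: "\<forall>x\<in>X. h x \<in> {..<n} \<rightarrow>\<^sub>E {..<2*n}"
    "\<forall>x\<in>X. \<forall>y\<in>X. x \<noteq> y \<longrightarrow> card {r. r < n \<and> h x r = h y r} \<le> k" by auto
  define Bad where "Bad = (\<lambda>x. {g \<in> {..<n} \<rightarrow>\<^sub>E {..<2*n}. card {r. r < n \<and> g r = h x r} > k})"
  \<comment> \<open>Each codeword chosen so far excludes at most a 2^-(k+1) fraction of all words,
    and there are at most 2^k of them, so some word \<open>g\<close> remains for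
    \<open>z\<close>.\<close>
  have "card (\<Union>x\<in>X. Bad x) * 2 ^ Suc k \<le> (\<Sum>x\<in>X. card (Bad x)) * 2 ^ Suc k"
    by (intro mult_right_mono card_UN_le insert.hyps) simp
  also have "\<dots> = (\<Sum>x\<in>X. card (Bad x) * 2 ^ Suc k)" by (simp only: sum_distrib_right)
  also have "\<dots> \<le> (\<Sum>x\<in>X. (2*n) ^ n)"
    unfolding Bad_def by (intro sum_mono card_words_agreeing_le assms(3))
  also have "\<dots> = card X * (2*n) ^ n" by simp
  also have "\<dots> < 2 ^ Suc k * (2*n) ^ n"
    using insert assms(3) by (intro mult_strict_right_mono) auto
  finally have "card (\<Union>x\<in>X. Bad x) < card ({..<n} \<rightarrow>\<^sub>E {..<2*n})"
    by (simp add: card_PiE)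
  then have "\<not> ({..<n} \<rightarrow>\<^sub>E {..<2*n}) \<subseteq> (\<Union>x\<in>X. Bad x)"
    using card_mono[of "\<Union>x\<in>X. Bad x" "{..<n} \<rightarrow>\<^sub>E {..<2*n}"] insert.hyps(1)
    by (auto simp: Bad_def finite_PiE)
  then obtain g where g: "g \<in> {..<n} \<rightarrow>\<^sub>E {..<2*n}" "\<forall>x\<in>X. g \<notin> Bad x" by auto
  have "card {r. r < n \<and> g r = h x r} \<le> k" "card {r. r < n \<and> h x r = g r} \<le> k" if "x \<in> X" for x
    using g that unfolding Bad_def by (auto simp: not_less eq_commute)
  then show ?case
    using h g(1) insert.hyps by (intro exI[of _ "h(z := g)"]) auto
qed

text \<open>\<open>M X\<close> is the graph of the codeword of \<open>X\<close>: a message names a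
  position r and the symbol there, packed into the number r * 2n + \<open>h X r\<close>. Messages
  common to \<open>X\<close> and \<open>Y\<close> are positions where the codewords agree. With n =
  2^a there are n * 2n = 2^(2a+1) possible messages, hence 2a+1 qubits.\<close>

lemma exists_almost_disjoint_family:
  fixes a k :: nat
  obtains M :: "nat set \<Rightarrow> nat set"
  where "\<And>X. X \<subseteq> {..<k} \<Longrightarrow> M X \<subseteq> {..<2 ^ (2*a + 1)} \<and> card (M X) = 2 ^ a"
    and "\<And>X Y. X \<subseteq> {..<k} \<Longrightarrow> Y \<subseteq> {..<k} \<Longrightarrow> X \<noteq> Y \<Longrightarrow> card (M X \<inter> M Y) \<le> k"
proof -
  define n :: nat where "n = 2 ^ a"
  have n: "n > 0" by (simp add: n_def)
  obtain h :: "nat set \<Rightarrow> nat \<Rightarrow> nat" where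
    h1: "\<And>X. X \<subseteq> {..<k} \<Longrightarrow> h X \<in> {..<n} \<rightarrow>\<^sub>E {..<2*n}" and
    h2: "\<And>X Y. X \<subseteq> {..<k} \<Longrightarrow> Y \<subseteq> {..<k} \<Longrightarrow> X \<noteq> Y \<Longrightarrow> card {r. r < n \<and> h X r = h Y r} \<le> k"
    using exists_code[of "Pow {..<k}" k n] n by (simp add: card_Pow Ball_def Pow_iff) metis
  define M where "M = (\<lambda>X. (\<lambda>r. r * (2*n) + h X r) ` {..<n})"
  have lt: "h X r < 2*n" if "X \<subseteq> {..<k}" "r < n" for X r
    using h1[OF that(1)] that(2) by (auto simp: PiE_iff)
  have eq: "r = s \<and> h X r = h Y s"
    if "r * (2*n) + h X r = s * (2*n) + h Y s" "X \<subseteq> {..<k}" "Y \<subseteq> {..<k}" "r < n" "s < n" for X Y r s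
  proof -
    \<comment> \<open>Symbols are below 2n, so division by 2n recovers the position.\<close>
    have "(r * (2*n) + h X r) div (2*n) = r" "(s * (2*n) + h Y s) div (2*n) = s"
      using lt[OF that(2,4)] lt[OF that(3,5)] by simp_all
    then have "r = s" using that(1) by metis
    then show ?thesis using that(1) by auto
  qed
  show thesis
  proof
    fix X :: "nat set" assume X: "X \<subseteq> {..<k}"
    have less: "r * (2*n) + h X r < n * (2*n)" if "r < n" for r
    proof -
      have "r * (2*n) + h X r < Suc r * (2*n)" using lt[OF X that] by simp
      also have "\<dots> \<le> n * (2*n)" using that by (intro mult_right_mono) auto
      finally show ?thesis .
    qed
    have size: "n * (2*n) = 2 ^ (2*a + 1)" by (simp add: n_def power_add mult_2 distrib_left)
    have "M X \<subseteq> {..<2 ^ (2*a + 1)}" unfolding M_def size[symmetric] using less by blast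
    moreover have "inj_on (\<lambda>r. r * (2*n) + h X r) {..<n}"
      using eq X by (intro inj_onI) blast
    then have "card (M X) = 2 ^ a" unfolding M_def by (simp add: card_image n_def)
    ultimately show "M X \<subseteq> {..<2 ^ (2*a + 1)} \<and> card (M X) = 2 ^ a" ..
  next
    fix X Y :: "nat set" assume X: "X \<subseteq> {..<k}" and Y: "Y \<subseteq> {..<k}" and "X \<noteq> Y"
    have "M X \<inter> M Y \<subseteq> (\<lambda>r. r * (2*n) + h X r) ` {r. r < n \<and> h X r = h Y r}"
      unfolding M_def using eq X Y by blast
    then have "card (M X \<inter> M Y) \<le> card {r. r < n \<and> h X r = h Y r}"
      by (rule surj_card_le[rotated]) simp
    then show "card (M X \<inter> M Y) \<le> k" using h2[OF X Y \<open>X \<noteq> Y\<close>] by simp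
  qed
qed

section \<open>Elementary counting estimates\<close>

text \<open>A set of at most d elements results from d successive picks, each an element of
  \<open>A\<close> or nothing (\<open>None\<close>), which gives \<open>card A + 1\<close> options
  per pick.\<close>

lemma card_subsets_card_le:
  assumes "finite A"
  shows "card {D. D \<subseteq> A \<and> card D \<le> d} \<le> (card A + 1) ^ d"
proof (induction d)
  case 0
  have "{D. D \<subseteq> A \<and> card D \<le> 0} = {{}}" using assms finite_subset by fastforce
  then show ?case by simp
next
  case (Suc d)
  let ?F = "\<lambda>(x, D). set_option x \<union> D"
  let ?R = "insert None (Some ` A) \<times> {D. D \<subseteq> A \<and> card D \<le> d}"
  have "{D. D \<subseteq> A \<and> card D \<le> Suc d} \<subseteq> ?F ` ?R"
  proof
    fix D assume "D \<in> {D. D \<subseteq> A \<and> card D \<le> Suc d}"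
    then have D: "D \<subseteq> A" "card D \<le> Suc d" by auto
    show "D \<in> ?F ` ?R"
    proof (cases "D = {}")
      case True
      then show ?thesis by (intro image_eqI[of _ _ "(None, {})"]) auto
    next
      case False
      then obtain x where x: "x \<in> D" by auto
      have "finite D" using D assms finite_subset by auto
      then have "D = ?F (Some x, D - {x})" "(Some x, D - {x}) \<in> ?R"
        using D x by auto
      then show ?thesis by (rule image_eqI)
    qed
  qed
  then have "card {D. D \<subseteq> A \<and> card D \<le> Suc d} \<le> card ?R"
    by (rule surj_card_le[rotated]) (use assms in auto)
  also have "\<dots> = (card A + 1) * card {D. D \<subseteq> A \<and> card D \<le> d}"
    using assms by (subst card_cartesian_product) (simp add: card_image)
  also have "\<dots> \<le> (card A + 1) * (card A + 1) ^ d" using Suc by (intro mult_left_mono) auto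
  also have "\<dots> = (card A + 1) ^ Suc d" by simp
  finally show ?case .
qed

text \<open>A reverse Bernoulli inequality: while 2jx is at most 1, the cross term 2jx * x is at
  most x, so each further factor adds at most 2x.\<close>

lemma one_plus_power_le:
  fixes x :: real
  assumes "0 \<le> x" "2 * real j * x \<le> 1"
  shows "(1 + x) ^ j \<le> 1 + 2 * real j * x"
  using assms(2)
proof (induction j)
  case (Suc j)
  have j: "2 * real j * x \<le> 1" using Suc.prems assms(1) by (simp add: algebra_simps)
  have "(1 + x) ^ Suc j \<le> (1 + x) * (1 + 2 * real j * x)"
    using Suc.IH[OF j] assms(1) by (simp add: mult_left_mono)
  also have "\<dots> = 1 + x + 2 * real j * x + (2 * real j * x) * x" by (simp add: algebra_simps)
  also have "\<dots> \<le> 1 + x + 2 * real j * x + 1 * x"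
    using j assms(1) by (intro add_left_mono mult_right_mono)
  finally show ?case by (simp add: algebra_simps)
qed simp

text \<open>Summed over all subsets, the weights give (1+x)^|A| by expanding the product, and the
  empty set accounts for the 1. This is the union bound over false candidates in which every node is
  likely to object.\<close>

lemma sum_power_card_nonempty_le:
  fixes x :: real
  assumes "finite A" "0 \<le> x" "2 * real (card A) * x \<le> 1"
  shows "(\<Sum>S\<in>Pow A - {{}}. x ^ card S) \<le> 2 * real (card A) * x"
proof -
  have "(\<Prod>i\<in>A. x + 1) = (\<Sum>S\<in>Pow A. (\<Prod>i\<in>S. x) * (\<Prod>i\<in>A - S. 1))"
    by (rule prod_add[OF assms(1)])
  then have "(\<Sum>S\<in>Pow A. x ^ card S) = (1 + x) ^ card A" by (simp add: add.commute)
  also have "\<dots> \<le> 1 + 2 * real (card A) * x" by (rule one_plus_power_le[OF assms(2,3)])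
  finally show ?thesis using assms(1) by (simp add: sum_diff1)
qed

section \<open>Candidate sets and the neighbourhoods compatible with them\<close>

text \<open>What player v must see if v is not to refute the candidate S.\<close>

definition plausible_nbhds :: "nat \<Rightarrow> nat \<Rightarrow> nat set \<Rightarrow> nat \<Rightarrow> nat set set" where
  "plausible_nbhds k d S v = (\<lambda>D. (S - {v}) \<union> D) ` {D. D \<subseteq> {..<k} - S \<and> card D \<le> d}"

lemma plausible_nbhds_subset: "S \<subseteq> {..<k} \<Longrightarrow> X \<in> plausible_nbhds k d S v \<Longrightarrow> X \<subseteq> {..<k}"
  unfolding plausible_nbhds_def by auto

lemma finite_plausible_nbhds: "finite (plausible_nbhds k d S v)"
  unfolding plausible_nbhds_def by simp

lemma card_plausible_nbhds_le: "card (plausible_nbhds k d S v) \<le> (k + 1) ^ d"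
proof -
  have "card (plausible_nbhds k d S v) \<le> card {D. D \<subseteq> {..<k} - S \<and> card D \<le> d}"
    unfolding plausible_nbhds_def by (intro card_image_le) simp
  also have "\<dots> \<le> card {D. D \<subseteq> {..<k} \<and> card D \<le> d}"
    by (intro card_mono) auto
  also have "\<dots> \<le> (k + 1) ^ d"
    using card_subsets_card_le[of "{..<k}" d] by simp
  finally show ?thesis .
qed

text \<open>Being a clique and being isolated are both conjunctions over v in \<open>S\<close> of
  conditions on the neighbourhood of v alone, with \<open>D\<close> the set of neighbours outside
  \<open>S\<close>. Hence each member can be tested through its own message.\<close>

lemma isolated_cliques_eq:
  assumes "graph_on k G"
  shows "isolated_cliques k G d =
    {S. S \<subseteq> {..<k} \<and> S \<noteq> {} \<and> (\<forall>v\<in>S. nbhd k G v \<in> plausible_nbhds k d S v)}"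
proof -
  have G: "\<not> G v v" "G u v \<Longrightarrow> u < k \<and> v < k" for u v using assms unfolding graph_on_def by auto
  have *: "nbhd k G v \<in> plausible_nbhds k d S v \<longleftrightarrow>
    (\<forall>u\<in>S. u \<noteq> v \<longrightarrow> G v u) \<and> card {u. u < k \<and> u \<notin> S \<and> G v u} \<le> d"
    if S: "S \<subseteq> {..<k}" "v \<in> S" for S v
  proof
    assume "nbhd k G v \<in> plausible_nbhds k d S v"
    then obtain D where D: "D \<subseteq> {..<k} - S" "card D \<le> d" "nbhd k G v = (S - {v}) \<union> D"
      unfolding plausible_nbhds_def by auto
    have "{u. u < k \<and> u \<notin> S \<and> G v u} = nbhd k G v - S" unfolding nbhd_def by auto
    also have "\<dots> = D" using D by auto
    finally have "card {u. u < k \<and> u \<notin> S \<and> G v u} \<le> d" using D by simp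
    moreover have "G v u" if "u \<in> S" "u \<noteq> v" for u
    proof -
      have "u \<in> nbhd k G v" using D that by auto
      then show ?thesis by (simp add: nbhd_def)
    qed
    ultimately show "(\<forall>u\<in>S. u \<noteq> v \<longrightarrow> G v u) \<and> card {u. u < k \<and> u \<notin> S \<and> G v u} \<le> d" by auto
  next
    assume A: "(\<forall>u\<in>S. u \<noteq> v \<longrightarrow> G v u) \<and> card {u. u < k \<and> u \<notin> S \<and> G v u} \<le> d"
    have "nbhd k G v = (S - {v}) \<union> {u. u < k \<and> u \<notin> S \<and> G v u}"
      using A S G unfolding nbhd_def by auto
    then show "nbhd k G v \<in> plausible_nbhds k d S v"
      unfolding plausible_nbhds_def using A by (intro image_eqI) auto
  qed
  show ?thesis
    unfolding isolated_cliques_def max_d_isolated_clique_def is_clique_def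
    using * by (intro Collect_cong) (auto; blast)
qed

text \<open>Adding v to its neighbourhood gives the disjoint union of \<open>S\<close> and
  \<open>D\<close>, so one supporting node determines \<open>S\<close> up to the deletion of at most
  d elements.\<close>

lemma nbhd_plausible_imp_minus:
  assumes "nbhd k G v \<in> plausible_nbhds k d S v" "v \<in> S"
  shows "S \<in> (\<lambda>D. insert v (nbhd k G v) - D) ` {D. D \<subseteq> {..<k} \<and> card D \<le> d}"
proof -
  obtain D where D: "D \<subseteq> {..<k} - S" "card D \<le> d" "nbhd k G v = (S - {v}) \<union> D"
    using assms(1) unfolding plausible_nbhds_def by auto
  have "S = insert v (nbhd k G v) - D" using D assms(2) by auto
  then show ?thesis using D by auto
qed

text \<open>For a fixed graph, \<open>S\<close> can be recovered from a supporting node v and the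
  deleted set \<open>D\<close>.\<close>

lemma card_supported_candidates_le:
  "card {S. S \<subseteq> {..<k} \<and> (\<exists>v\<in>S. nbhd k G v \<in> plausible_nbhds k d S v)} \<le> k * (k + 1) ^ d"
proof -
  let ?D = "{D. D \<subseteq> {..<k} \<and> card D \<le> d}"
  let ?R = "(\<lambda>(v, D). insert v (nbhd k G v) - D) ` ({..<k} \<times> ?D)"
  have "{S. S \<subseteq> {..<k} \<and> (\<exists>v\<in>S. nbhd k G v \<in> plausible_nbhds k d S v)} \<subseteq> ?R"
    using nbhd_plausible_imp_minus by fastforce
  then have "card {S. S \<subseteq> {..<k} \<and> (\<exists>v\<in>S. nbhd k G v \<in> plausible_nbhds k d S v)}
      \<le> card ({..<k} \<times> ?D)"
    by (rule surj_card_le[rotated]) simp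
  also have "\<dots> = k * card ?D" by (simp add: card_cartesian_product)
  also have "\<dots> \<le> k * (k + 1) ^ d"
    using card_subsets_card_le[of "{..<k}" d] by (intro mult_left_mono) auto
  finally show ?thesis .
qed

section \<open>The referee and its error probability\<close>

text \<open>Independence of the private coins in counting form: every coordinate in \<open>B\<close>
  contributes a factor of at most \<delta>n, every other one exactly n.\<close>

lemma card_PiE_restricted_le:
  fixes \<delta> :: real and f g :: "nat \<Rightarrow> nat set"
  assumes "B \<subseteq> {..<k}" "0 \<le> \<delta>"
    and "\<And>v. v < k \<Longrightarrow> finite (g v) \<and> card (g v) = n"
    and "\<And>v. v \<in> B \<Longrightarrow> real (card (f v)) \<le> \<delta> * real n"
  shows "real (card (\<Pi>\<^sub>E v\<in>{..<k}. if v \<in> B then f v else g v)) \<le> \<delta> ^ card B * real n ^ k"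
proof -
  have "real (card (\<Pi>\<^sub>E v\<in>{..<k}. if v \<in> B then f v else g v))
      = (\<Prod>v<k. real (card (if v \<in> B then f v else g v)))"
    by (subst card_PiE) auto
  also have "\<dots> \<le> (\<Prod>v<k. (if v \<in> B then \<delta> else 1) * real n)"
    using assms by (intro prod_mono) auto
  also have "\<dots> = (\<Prod>v<k. if v \<in> B then \<delta> else 1) * real n ^ k"
    by (simp add: prod.distrib)
  also have "(\<Prod>v<k. if v \<in> B then \<delta> else 1) = (\<Prod>v\<in>B. \<delta>)"
    using assms(1) by (intro prod.mono_neutral_cong_right) auto
  finally show ?thesis by simp
qed

text \<open>The outside neighbours of v are unknown to the referee, so a message passes if any
  plausible neighbourhood of v could have produced it.\<close>

definition referee :: "nat \<Rightarrow> nat \<Rightarrow> (nat set \<Rightarrow> nat set) \<Rightarrow> (nat \<Rightarrow> nat) \<Rightarrow> nat set set" where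
  "referee k d M i = {S. S \<subseteq> {..<k} \<and> S \<noteq> {} \<and> (\<forall>v\<in>S. i v \<in> (\<Union>X\<in>plausible_nbhds k d S v. M X))}"

text \<open>Union bound over the false candidates \<open>F\<close>, where \<open>R S\<close> is the
  event that \<open>S\<close> passes. The first summand pays for candidates whose nodes all have
  implausible neighbourhoods, the second for the few that some node supports. The factor n^k is the
  number of message tuples.\<close>

lemma card_referee_errs_le:
  fixes M :: "nat set \<Rightarrow> nat set" and \<delta> :: real
  assumes G: "graph_on k G" and "n > 0"
    and M: "\<And>X. X \<subseteq> {..<k} \<Longrightarrow> finite (M X) \<and> card (M X) = n"
    and disj: "\<And>X Y. X \<subseteq> {..<k} \<Longrightarrow> Y \<subseteq> {..<k} \<Longrightarrow> X \<noteq> Y \<Longrightarrow> card (M X \<inter> M Y) \<le> k"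
    and \<delta>: "real ((k + 1) ^ Suc d) = \<delta> * real n" "2 * real k * \<delta> \<le> 1" "\<delta> \<le> 1"
  shows "real (card {i \<in> (\<Pi>\<^sub>E v\<in>{..<k}. M (nbhd k G v)). referee k d M i \<noteq> isolated_cliques k G d})
    \<le> (2 * real k * \<delta> + real ((k + 1) ^ Suc d) * \<delta>) * real n ^ k"
proof -
  define \<Omega> where "\<Omega> = (\<Pi>\<^sub>E v\<in>{..<k}. M (nbhd k G v))"
  define acc where "acc = (\<lambda>S v. \<Union>X\<in>plausible_nbhds k d S v. M X)"
  define bad where "bad = (\<lambda>S. {v\<in>S. nbhd k G v \<notin> plausible_nbhds k d S v})"
  define R where "R = (\<lambda>S. {i\<in>\<Omega>. \<forall>v\<in>S. i v \<in> acc S v})"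
  define F where "F = {S. S \<subseteq> {..<k} \<and> bad S \<noteq> {}}"
  have \<delta>0: "0 \<le> \<delta>"
  proof -
    have "0 \<le> \<delta> * real n" unfolding \<delta>(1)[symmetric] by (rule of_nat_0_le_iff)
    then show ?thesis using \<open>n > 0\<close> by (simp add: zero_le_mult_iff)
  qed
  have N: "nbhd k G v \<subseteq> {..<k}" for v by (auto simp: nbhd_def)
  have fin\<Omega>: "finite \<Omega>" unfolding \<Omega>_def using M[OF N] by (intro finite_PiE) auto
  have finF: "finite F" unfolding F_def by simp
  \<comment> \<open>The true neighbourhood of a bad node differs from each of the at most (k+1)^d
    plausible ones and shares at most k messages with each; the total is at most (k+1)^(d+1) =
    \<delta>n.\<close>
  have cardacc: "real (card (M (nbhd k G v) \<inter> acc S v)) \<le> \<delta> * real n"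
    if "S \<subseteq> {..<k}" "v \<in> bad S" for S v
  proof -
    have "card (M (nbhd k G v) \<inter> acc S v) = card (\<Union>X\<in>plausible_nbhds k d S v. M (nbhd k G v) \<inter> M X)"
      unfolding acc_def by (simp only: Int_UN_distrib)
    also have "\<dots> \<le> (\<Sum>X\<in>plausible_nbhds k d S v. card (M (nbhd k G v) \<inter> M X))"
      by (intro card_UN_le finite_plausible_nbhds)
    also have "\<dots> \<le> (\<Sum>X\<in>plausible_nbhds k d S v. k)"
      using that plausible_nbhds_subset N unfolding bad_def by (intro sum_mono disj) auto
    also have "\<dots> \<le> (k + 1) ^ d * (k + 1)"
      by (simp only: sum_constant of_nat_id) (intro mult_mono card_plausible_nbhds_le, auto)
    finally show ?thesis unfolding \<delta>(1)[symmetric] of_nat_le_iff by (simp add: mult.commute)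
  qed
  have cardR: "real (card (R S)) \<le> \<delta> ^ card (bad S) * real n ^ k" if S: "S \<subseteq> {..<k}" for S
  proof -
    have sub: "bad S \<subseteq> {..<k}" using S unfolding bad_def by auto
    \<comment> \<open>Only the tests at bad nodes are kept as restrictions; the other nodes of
      \<open>S\<close> pass with every message they may send.\<close>
    have "R S \<subseteq> (\<Pi>\<^sub>E v\<in>{..<k}. if v \<in> bad S then M (nbhd k G v) \<inter> acc S v else M (nbhd k G v))"
      unfolding R_def \<Omega>_def bad_def by (auto simp: PiE_iff extensional_def)
    then have "card (R S)
        \<le> card (\<Pi>\<^sub>E v\<in>{..<k}. if v \<in> bad S then M (nbhd k G v) \<inter> acc S v else M (nbhd k G v))"
      using M[OF N] by (intro card_mono finite_PiE) auto
    also have "real \<dots> \<le> \<delta> ^ card (bad S) * real n ^ k"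
      using sub \<delta>0 M[OF N] cardacc[OF S] by (intro card_PiE_restricted_le) auto
    finally show ?thesis by simp
  qed
  \<comment> \<open>The error is one-sided: every isolated clique is accepted, so a wrong output
    contains a false candidate that passed.\<close>
  have sub: "{i \<in> \<Omega>. referee k d M i \<noteq> isolated_cliques k G d} \<subseteq> (\<Union>S\<in>F. R S)"
  proof
    fix i assume "i \<in> {i \<in> \<Omega>. referee k d M i \<noteq> isolated_cliques k G d}"
    then have i: "i \<in> \<Omega>" "referee k d M i \<noteq> isolated_cliques k G d" by auto
    have "isolated_cliques k G d \<subseteq> referee k d M i"
      unfolding isolated_cliques_eq[OF G] referee_def using i(1)
      unfolding \<Omega>_def by (auto simp: PiE_iff subset_iff)
    then obtain S where S: "S \<in> referee k d M i" "S \<notin> isolated_cliques k G d" using i(2) by auto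
    then have "S \<in> F" "i \<in> R S"
      using i(1) unfolding isolated_cliques_eq[OF G] referee_def F_def R_def bad_def acc_def by auto
    then show "i \<in> (\<Union>S\<in>F. R S)" by auto
  qed
  have "card {i \<in> \<Omega>. referee k d M i \<noteq> isolated_cliques k G d} \<le> card (\<Union>S\<in>F. R S)"
    using sub finF fin\<Omega> by (intro card_mono) (auto simp: R_def)
  also have "\<dots> \<le> (\<Sum>S\<in>F. card (R S))" by (rule card_UN_le[OF finF])
  also have "real \<dots> \<le> (\<Sum>S\<in>F. \<delta> ^ card (bad S)) * real n ^ k"
    unfolding of_nat_sum sum_distrib_right using cardR by (intro sum_mono) (auto simp: F_def)
  also have "(\<Sum>S\<in>F. \<delta> ^ card (bad S)) \<le> 2 * real k * \<delta> + real ((k + 1) ^ Suc d) * \<delta>"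
  proof -
    \<comment> \<open>\<open>H\<close> collects the false candidates that still have a supporting
      node. They are few, so one factor \<delta> from one bad node suffices; the others may be
      numerous and need the full weight \<delta>^|S|.\<close>
    define H where "H = {S\<in>F. bad S \<noteq> S}"
    have "F = {S\<in>F. bad S = S} \<union> H" "{S\<in>F. bad S = S} \<inter> H = {}" "finite H"
      using finF unfolding H_def by auto
    then have "(\<Sum>S\<in>F. \<delta> ^ card (bad S))
        = (\<Sum>S\<in>{S\<in>F. bad S = S}. \<delta> ^ card (bad S)) + (\<Sum>S\<in>H. \<delta> ^ card (bad S))"
      using finF sum.union_disjoint[of "{S\<in>F. bad S = S}" H "\<lambda>S. \<delta> ^ card (bad S)"] by simp
    moreover have "(\<Sum>S\<in>{S\<in>F. bad S = S}. \<delta> ^ card (bad S)) \<le> 2 * real k * \<delta>"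
    proof -
      have "(\<Sum>S\<in>{S\<in>F. bad S = S}. \<delta> ^ card (bad S)) = (\<Sum>S\<in>{S\<in>F. bad S = S}. \<delta> ^ card S)"
        by (intro sum.cong) auto
      also have "\<dots> \<le> (\<Sum>S\<in>Pow {..<k} - {{}}. \<delta> ^ card S)"
        using \<delta>0 unfolding F_def by (intro sum_mono2) auto
      also have "\<dots> \<le> 2 * real k * \<delta>"
        using sum_power_card_nonempty_le[of "{..<k}" \<delta>] \<delta>0 \<delta>(2) by simp
      finally show ?thesis .
    qed
    moreover have "(\<Sum>S\<in>H. \<delta> ^ card (bad S)) \<le> real ((k + 1) ^ Suc d) * \<delta>"
    proof -
      have "\<delta> ^ card (bad S) \<le> \<delta>" if "S \<in> H" for S
      proof -
        have S: "S \<subseteq> {..<k}" "bad S \<noteq> {}" using that unfolding H_def F_def by auto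
        then have "finite (bad S)" using finite_subset unfolding bad_def by fastforce
        then have "1 \<le> card (bad S)" using S by (simp add: Suc_leI card_gt_0_iff)
        then have "\<delta> ^ card (bad S) \<le> \<delta> ^ 1" using \<delta>0 \<delta>(3) by (intro power_decreasing) auto
        then show ?thesis by simp
      qed
      then have "(\<Sum>S\<in>H. \<delta> ^ card (bad S)) \<le> (\<Sum>S\<in>H. \<delta>)" by (rule sum_mono)
      also have "\<dots> = real (card H) * \<delta>" by simp
      also have "\<dots> \<le> real ((k + 1) ^ Suc d) * \<delta>"
      proof -
        have "H \<subseteq> {S. S \<subseteq> {..<k} \<and> (\<exists>v\<in>S. nbhd k G v \<in> plausible_nbhds k d S v)}"
          unfolding H_def F_def bad_def by auto
        then have "card H \<le> card {S. S \<subseteq> {..<k} \<and> (\<exists>v\<in>S. nbhd k G v \<in> plausible_nbhds k d S v)}"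
          by (intro card_mono) auto
        also have "\<dots> \<le> k * (k + 1) ^ d" by (rule card_supported_candidates_le)
        also have "\<dots> \<le> (k + 1) ^ Suc d" by simp
        finally show ?thesis using \<delta>0 by (intro mult_right_mono) (simp_all only: of_nat_le_iff)
      qed
      finally show ?thesis .
    qed
    ultimately show ?thesis by linarith
  qed
  finally show ?thesis unfolding \<Omega>_def by (simp add: mult_right_mono)
qed

section \<open>Choice of parameters, cost and success probability\<close>

theorem theorem19:
  "\<exists>C::real. C > 0 \<and>
    (\<forall>d::nat. d \<ge> 1 \<longrightarrow> (\<forall>k::nat. k \<ge> 2 \<longrightarrow>
      (\<exists>(m :: nat \<Rightarrow> nat) (\<rho> :: nat \<Rightarrow> nat set \<Rightarrow> nat \<Rightarrow> nat \<Rightarrow> complex)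
         (Outs :: nat set set set) E.
         nih_protocol k m \<rho> Outs E \<and>
         real (nih_cost k m) \<le> C * real k * real d * (log 2 (real k))^2 \<and>
         (\<forall>G. graph_on k G \<longrightarrow>
            output_prob k m \<rho> Outs E G (isolated_cliques k G d) \<ge> 2/3))))"
proof (intro exI[of _ "36::real"] conjI allI impI)
  fix d k :: nat
  assume d: "d \<ge> 1" and k: "k \<ge> 2"
  \<comment> \<open>\<open>L\<close> is the least exponent with k < 2^\<open>L\<close>, hence k+1
    \<le> 2^\<open>L\<close>, and the choice of \<open>a\<close> makes n at least
    (k+1)^(6d).\<close>
  define L where "L = Suc (floor_log k)"
  define a where "a = 6 * d * L"
  define n :: nat where "n = 2 ^ a"
  define q where "q = real (k + 1)"
  define \<delta> where "\<delta> = q ^ Suc d / real n"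
  have n0: "n > 0" by (simp add: n_def)
  have log1: "1 \<le> log 2 (real k)" using k by simp
  have "real (floor_log k) \<le> log 2 (real k)"
    using floor_log_exp2_le[of k] k by (simp add: le_log_iff powr_realpow flip: of_nat_power)
  then have L_le: "real L \<le> 2 * log 2 (real k)" using log1 unfolding L_def by linarith
  have "k < 2 ^ L" unfolding L_def using floor_log_exp2_gt[of k] by simp
  then have "k + 1 \<le> 2 ^ L" by simp
  then have "(k + 1) ^ (6 * d) \<le> (2 ^ L) ^ (6 * d)" by (rule power_mono) simp
  also have "\<dots> = n" unfolding n_def a_def by (simp add: power_mult[symmetric] mult_ac)
  finally have n_ge: "q ^ (6 * d) \<le> real n"
    unfolding q_def by (metis of_nat_le_iff of_nat_power)
  have q3: "3 \<le> q" using k unfolding q_def by simp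
  have pow: "real ((k + 1) ^ Suc d) = q ^ Suc d" unfolding q_def by (rule of_nat_power)
  \<comment> \<open>The error 2k\<delta> + q^(d+1)\<delta> is at most 3 q^(d+1)\<delta>, and it must
    not exceed 1/3; hence the 9. Since \<delta> = q^(d+1)/n and 9 \<le> q^2, it suffices that n
    \<ge> q^(2d+4), and 2d+4 \<le> 6d because d \<ge> 1.\<close>
  have err: "9 * (q ^ Suc d * \<delta>) \<le> 1"
  proof -
    have "9 * (q ^ Suc d * q ^ Suc d) \<le> q ^ 2 * (q ^ Suc d * q ^ Suc d)"
      using q3 power_mono[of 3 q 2] by (intro mult_right_mono) auto
    also have "\<dots> = q ^ (2 + Suc d + Suc d)" by (simp add: power_add power2_eq_square)
    also have "\<dots> \<le> q ^ (6 * d)" using q3 d by (intro power_increasing) auto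
    finally show ?thesis using n_ge n0 unfolding \<delta>_def by (simp add: field_simps)
  qed
  have \<delta>0: "0 \<le> \<delta>" using q3 unfolding \<delta>_def by simp
  have "q ^ 1 \<le> q ^ Suc d" using q3 by (intro power_increasing) auto
  then have qd: "q * \<delta> \<le> q ^ Suc d * \<delta>" using \<delta>0 by (intro mult_right_mono) auto
  have k\<delta>: "real k * \<delta> \<le> q * \<delta>" using \<delta>0 unfolding q_def by (intro mult_right_mono) auto
  have "1 * \<delta> \<le> q * \<delta>" using q3 \<delta>0 by (intro mult_right_mono) auto
  then have \<delta>1: "\<delta> \<le> 1" using qd err by linarith

  obtain M :: "nat set \<Rightarrow> nat set" where
    M1: "\<And>X. X \<subseteq> {..<k} \<Longrightarrow> M X \<subseteq> {..<2 ^ (2*a + 1)} \<and> card (M X) = 2 ^ a" and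
    M2: "\<And>X Y. X \<subseteq> {..<k} \<Longrightarrow> Y \<subseteq> {..<k} \<Longrightarrow> X \<noteq> Y \<Longrightarrow> card (M X \<inter> M Y) \<le> k"
    using exists_almost_disjoint_family[where a = a and k = k] by metis
  have finM: "finite (M X) \<and> card (M X) = n" if "X \<subseteq> {..<k}" for X
    using M1[OF that] finite_subset unfolding n_def by auto
  have ref: "referee k d M i \<in> Pow (Pow {..<k})" for i unfolding referee_def by auto
  obtain \<rho> E where prot: "nih_protocol k (\<lambda>v. 2*a + 1) \<rho> (Pow (Pow {..<k})) E"
    and prob: "\<And>G w. w \<in> Pow (Pow {..<k}) \<Longrightarrow>
      output_prob k (\<lambda>v. 2*a + 1) \<rho> (Pow (Pow {..<k})) E G w =
      real (card {i \<in> (\<Pi>\<^sub>E v\<in>{..<k}. M (nbhd k G v)). referee k d M i = w}) / real n ^ k"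
  proof (rule classical_nih_protocol[where M = M and k = k and a = "2*a+1" and n = n
        and ref = "referee k d M" and Outs = "Pow (Pow {..<k})"])
    show "M N \<subseteq> {..<2 ^ (2*a + 1)} \<and> card (M N) = n" if "N \<subseteq> {..<k}" for N
      using M1[OF that] by (simp add: n_def)
  qed (use n0 ref in \<open>simp_all only: finite_Pow_iff finite_lessThan\<close>)
  \<comment> \<open>36 = 3 * 6 * 2, from 2a+1 \<le> 3a, a = 6d\<open>L\<close> and \<open>L\<close>
    \<le> 2 log k. The bound obtained is linear in log k; the square is then reached from log k
    \<ge> 1.\<close>
  have cost: "real (nih_cost k (\<lambda>v. 2*a + 1)) \<le> 36 * real k * real d * (log 2 (real k))^2"
  proof -
    have "1 \<le> a" using d unfolding a_def L_def by simp
    then have "real k * real (2*a + 1) \<le> real k * (3 * real a)"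
      by (intro mult_left_mono) auto
    then have "real (nih_cost k (\<lambda>v. 2*a + 1)) \<le> real k * (3 * real a)"
      unfolding nih_cost_def by (simp only: sum_constant card_lessThan of_nat_mult of_nat_id)
    also have "\<dots> = 18 * real k * real d * real L" unfolding a_def by simp
    also have "\<dots> \<le> 18 * real k * real d * (2 * log 2 (real k))"
      using L_le by (intro mult_left_mono) auto
    also have "\<dots> = 36 * real k * real d * log 2 (real k) ^ 1" by simp
    also have "\<dots> \<le> 36 * real k * real d * (log 2 (real k))^2"
      using log1 by (intro mult_left_mono power_increasing) auto
    finally show ?thesis .
  qed
  have "output_prob k (\<lambda>v. 2*a + 1) \<rho> (Pow (Pow {..<k})) E G (isolated_cliques k G d) \<ge> 2/3"
    if G: "graph_on k G" for G
  proof -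
    define \<Omega> where "\<Omega> = (\<Pi>\<^sub>E v\<in>{..<k}. M (nbhd k G v))"
    define good where "good = {i\<in>\<Omega>. referee k d M i = isolated_cliques k G d}"
    define wrong where "wrong = {i\<in>\<Omega>. referee k d M i \<noteq> isolated_cliques k G d}"
    have N: "nbhd k G v \<subseteq> {..<k}" for v by (auto simp: nbhd_def)
    have fin: "finite \<Omega>" unfolding \<Omega>_def using finM[OF N] by (intro finite_PiE) auto
    have "card \<Omega> = n ^ k" unfolding \<Omega>_def using finM[OF N] by (simp add: card_PiE)
    moreover have "card \<Omega> = card good + card wrong"
      using fin unfolding good_def wrong_def
      by (subst card_Un_disjoint[symmetric]) (auto intro!: arg_cong[of _ _ card])
    ultimately have total: "real n ^ k = real (card good) + real (card wrong)"
      by (metis of_nat_add of_nat_power)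
    have "real (card wrong) \<le> (2 * real k * \<delta> + real ((k + 1) ^ Suc d) * \<delta>) * real n ^ k"
      unfolding wrong_def \<Omega>_def
    proof (rule card_referee_errs_le[OF G n0 finM M2])
      show "real ((k + 1) ^ Suc d) = \<delta> * real n" using n0 unfolding pow \<delta>_def by simp
    qed (use k\<delta> qd err \<delta>1 in auto)
    also have "\<dots> \<le> 1/3 * real n ^ k"
    proof (rule mult_right_mono)
      show "2 * real k * \<delta> + real ((k + 1) ^ Suc d) * \<delta> \<le> 1/3"
        unfolding pow using k\<delta> qd err by linarith
    qed simp
    finally have "2/3 * real n ^ k \<le> real (card good)" using total by linarith
    then have "2/3 \<le> real (card good) / real n ^ k" using n0 by (simp add: pos_le_divide_eq)
    moreover have "isolated_cliques k G d \<in> Pow (Pow {..<k})"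
      unfolding isolated_cliques_def max_d_isolated_clique_def by auto
    ultimately show ?thesis unfolding prob[OF \<open>isolated_cliques k G d \<in> _\<close>] good_def \<Omega>_def by simp
  qed
  then show "\<exists>(m :: nat \<Rightarrow> nat) (\<rho> :: nat \<Rightarrow> nat set \<Rightarrow> nat \<Rightarrow> nat \<Rightarrow> complex)
         (Outs :: nat set set set) E.
         nih_protocol k m \<rho> Outs E \<and>
         real (nih_cost k m) \<le> 36 * real k * real d * (log 2 (real k))^2 \<and>
         (\<forall>G. graph_on k G \<longrightarrow>
            output_prob k m \<rho> Outs E G (isolated_cliques k G d) \<ge> 2/3)"
    using prot cost by blast
qed simp

end
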